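(* Let $q>3$ be a prime power, let $n<q$ and $1\le m\le\lfloor (n+1)/2\rfloor$, let $a=(a_1,\ldots,a_n)\in\mathbb{F}_q^n$ have pairwise distinct entries and let $v=(v_1,\ldots,v_n)\in(\mathbb{F}_q^* )^n$. Suppose that the extended generalized Reed-Solomon code $\mathrm{GRS}_m(a,v,\infty)$ is Euclidean self-orthogonal, i.e. contained in its Euclidean dual. Then for all integers $k,l$ with $1\le k\le m$ and $0\le l\le k$, there exists a $q$-ary $[n+1,k]$ MDS code $C$ with $\dim(\mathrm{Hull}(C))=l$.
   Context: $\mathbb{F}_q$ is the finite field with $q$ elements and $\mathbb{F}_q^*=\mathbb{F}_q\setminus\{0\}$. A $q$-ary $[N,k]$ code is a $k$-dimensional linear subspace of $\mathbb{F}_q^N$; it is MDS (for $k\ge 1$) if its minimum Hamming distance is $N-k+1$. The Euclidean dual of $C\subseteq\mathbb{F}_q^N$ is $C^\perp=\{x\in\mathbb{F}_q^N:\sum_{i=1}^N x_iy_i=0\text{ for all }y\in C\}$, and the (Euclidean) hull is $\mathrm{Hull}(C)=C\cap C^\perp$. For $1\le n\le q$, $a=(a_1,\ldots,a_n)\in\mathbb{F}_q^n$ with distinct entries, $v\in(\mathbb{F}_q^* )^n$ and $1\le k\le n$, $$\mathrm{GRS}_k(a,v,\infty)=\{(v_1f(a_1),\ldots,v_nf(a_n),f_{k-1}): f\in\mathbb{F}_q[x],\ \deg f\le k-1\}\subseteq\mathbb{F}_q^{n+1},$$ where $f_{k-1}$ is the coefficient of $x^{k-1}$ in $f$. *)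

theory Defs
  imports "Jordan_Normal_Form.VS_Connect" "HOL-Library.Cardinality"
begin

text \<open>Words of length \<open>N\<close> over the field \<open>'a\<close> are the elements of \<^term>\<open>carrier_vec N\<close>, with
  coordinates numbered from \<open>0\<close>.  The inner product is the library's bilinear \<open>\<bullet>\<close>.\<close>

text \<open>The dimension of a linear code is that of the vector space obtained from the ambient
  space by restricting its carrier; it is meaningful only if \<open>C\<close> is a subspace.\<close>

definition code_dim :: "nat \<Rightarrow> 'a::field vec set \<Rightarrow> nat" where
  "code_dim N C = vectorspace.dim class_ring ((module_vec TYPE('a) N)\<lparr>carrier := C\<rparr>)"

definition linear_code :: "nat \<Rightarrow> nat \<Rightarrow> 'a::field vec set \<Rightarrow> bool" where
  "linear_code N k C \<longleftrightarrow>
     VectorSpace.subspace class_ring C (module_vec TYPE('a) N) \<and> code_dim N C = k"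

definition hamming_dist :: "'a vec \<Rightarrow> 'a vec \<Rightarrow> nat" where
  "hamming_dist x y = card {i. i < dim_vec x \<and> x $ i \<noteq> y $ i}"

text \<open>\<^const>\<open>Min\<close> is unspecified on the empty set, so this is meaningful only for codes with
  at least two words.\<close>

definition min_distance :: "'a vec set \<Rightarrow> nat" where
  "min_distance C = Min {hamming_dist x y | x y. x \<in> C \<and> y \<in> C \<and> x \<noteq> y}"

text \<open>A code as below has \<open>k \<le> N\<close>, so the subtraction does not truncate.\<close>

definition mds_code :: "nat \<Rightarrow> nat \<Rightarrow> 'a::field vec set \<Rightarrow> bool" where
  "mds_code N k C \<longleftrightarrow> 1 \<le> k \<and> linear_code N k C \<and> min_distance C = N - k + 1"

definition euclidean_dual :: "nat \<Rightarrow> 'a::field vec set \<Rightarrow> 'a vec set" where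
  "euclidean_dual N C = {x \<in> carrier_vec N. \<forall>y\<in>C. x \<bullet> y = 0}"

definition euclidean_hull :: "nat \<Rightarrow> 'a::field vec set \<Rightarrow> 'a vec set" where
  "euclidean_hull N C = C \<inter> euclidean_dual N C"

definition self_orthogonal :: "nat \<Rightarrow> 'a::field vec set \<Rightarrow> bool" where
  "self_orthogonal N C \<longleftrightarrow> C \<subseteq> euclidean_dual N C"

text \<open>The code \<open>GRS\<^sub>k(a, v, \<infinity>)\<close> of length \<open>n + 1\<close>, intended for \<open>a\<close> and \<open>v\<close> of length \<open>n\<close> and
  \<open>1 \<le> k \<le> n\<close>.  As \<^term>\<open>degree 0 = 0\<close>, the condition on the degree admits the zero
  polynomial.\<close>

definition extended_grs :: "nat \<Rightarrow> nat \<Rightarrow> 'a::field vec \<Rightarrow> 'a vec \<Rightarrow> 'a vec set" where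
  "extended_grs n k a v =
     {vec (n + 1) (\<lambda>i. if i < n then v $ i * poly f (a $ i) else coeff f (k - 1)) | f.
        degree f \<le> k - 1}"

end

theory Submission
  imports Defs
begin

text \<open>Let \<open>\<beta>\<close> be a field element outside the \<open>a\<^sub>i\<close>. The words of \<open>(x - \<beta>)\<^sup>m\<^sup>-\<^sup>k f\<close> with
  \<open>deg f < k\<close> form a subcode of \<open>GRS\<^sub>m(a, v, \<infinity>)\<close> which is again of the form
  \<open>GRS\<^sub>k(a, v', \<infinity>)\<close>, so one may assume \<open>m = k\<close>.  Since \<open>q > 3\<close> there is \<open>\<alpha> \<noteq> 0\<close> with
  \<open>\<alpha>\<^sup>2 \<noteq> 1\<close>.  Multiplying the first \<open>s = k - l\<close> entries of \<open>v\<close> by \<open>\<alpha>\<close> turns the inner product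
  of the words of \<open>f\<close> and \<open>g\<close> into \<open>(\<alpha>\<^sup>2 - 1) \<Sum>\<^sub>i\<^sub><\<^sub>s v\<^sub>i\<^sup>2 f(a\<^sub>i) g(a\<^sub>i)\<close>.  As \<open>s \<le> k\<close>, evaluation
  at the first \<open>s\<close> points is onto, so the hull consists of the words of the polynomials that
  vanish at these points, and these form a space of dimension \<open>k - s = l\<close>.\<close>

section \<open>Polynomials of bounded degree and linear codes parametrised by them\<close>

text \<open>The bound is put on coefficients so that \<open>d = 0\<close> yields only the zero
  polynomial; this is the case of a trivial hull.\<close>

definition polys_below :: "nat \<Rightarrow> 'a::zero poly set" where
  "polys_below d = {p. \<forall>i\<ge>d. coeff p i = 0}"

lemma polys_below_iff: "p \<in> polys_below d \<longleftrightarrow> p = 0 \<or> degree p < d"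
  unfolding polys_below_def
  by (auto simp: coeff_eq_0) (metis leading_coeff_0_iff not_less)

lemma polys_below_eq_degree_le: "1 \<le> k \<Longrightarrow> polys_below k = {p. degree p \<le> k - 1}"
  by (auto simp: polys_below_iff)

lemma polys_below_diff:
  fixes p q :: "'a::ab_group_add poly"
  shows "p \<in> polys_below d \<Longrightarrow> q \<in> polys_below d \<Longrightarrow> p - q \<in> polys_below d"
  by (simp add: polys_below_def)

lemma polys_below_mult:
  fixes p q :: "'a::idom poly"
  assumes "degree p \<le> r" and "q \<in> polys_below d"
  shows "p * q \<in> polys_below (r + d)"
  using assms degree_mult_le[of p q] by (auto simp: polys_below_iff)

lemma polys_below_eq_image:
  "(polys_below d :: 'a::comm_monoid_add poly set) =
     (\<lambda>x. \<Sum>i<d. monom (x $ i) i) ` carrier_vec d"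
proof (intro equalityI subsetI)
  fix p :: "'a poly" assume p: "p \<in> polys_below d"
  have "p = (\<Sum>i<d. monom (vec d (coeff p) $ i) i)"
    using p by (auto intro!: poly_eqI simp: coeff_sum polys_below_def)
  then show "p \<in> (\<lambda>x. \<Sum>i<d. monom (x $ i) i) ` carrier_vec d"
    by (intro image_eqI[of _ _ "vec d (coeff p)"]) auto
qed (auto simp: polys_below_def coeff_sum)

text \<open>Composing \<open>\<phi>\<close> with the passage from coefficient vectors to polynomials
  gives a linear map \<open>T\<close> on a space of dimension \<open>d\<close>. By
  \<open>ker\<close> it is injective, so rank-nullity gives its image dimension \<open>d\<close>.
  This serves both the code and its hull.\<close>

lemma linear_code_image_polys_below:
  fixes \<phi> :: "'a::field poly \<Rightarrow> 'a vec"
  assumes carrier: "\<And>p. \<phi> p \<in> carrier_vec N"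
    and add: "\<And>p q. \<phi> (p + q) = \<phi> p + \<phi> q"
    and smult: "\<And>c p. \<phi> (Polynomial.smult c p) = c \<cdot>\<^sub>v \<phi> p"
    and ker: "\<And>p. p \<in> polys_below d \<Longrightarrow> \<phi> p = 0\<^sub>v N \<Longrightarrow> p = 0"
  shows "linear_code N d (\<phi> ` polys_below d)"
proof -
  define T :: "'a vec \<Rightarrow> 'a vec" where "T x = \<phi> (\<Sum>i<d. monom (x $ i) i)" for x
  interpret V: vec_space "TYPE('a)" d .
  interpret W: vec_space "TYPE('a)" N .
  have T_add: "T (x + y) = T x + T y" if "x \<in> carrier_vec d" "y \<in> carrier_vec d" for x y
    using that by (simp add: T_def add[symmetric] sum.distrib[symmetric] add_monom)
  have smult_sum: "Polynomial.smult c (\<Sum>i<d. g i) = (\<Sum>i<d. Polynomial.smult c (g i))"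
    for c and g :: "nat \<Rightarrow> 'a poly"
    by (induction d) (auto simp: smult_add_right)
  have T_smult: "T (c \<cdot>\<^sub>v x) = c \<cdot>\<^sub>v T x" if "x \<in> carrier_vec d" for c x
    using that by (simp add: T_def smult[symmetric] smult_sum smult_monom)
  have hom: "T \<in> LinearCombinations.module_hom class_ring
      (module_vec TYPE('a) d) (module_vec TYPE('a) N)"
    unfolding LinearCombinations.module_hom_def
    using T_add T_smult carrier by (auto simp: module_vec_simps T_def)
  interpret linear_map class_ring "module_vec TYPE('a) d" "module_vec TYPE('a) N" T
    by unfold_locales (rule hom)
  have ker_T: "x = 0\<^sub>v d" if "x \<in> carrier_vec d" "T x = 0\<^sub>v N" for x
  proof -
    have "(\<Sum>i<d. monom (x $ i) i) = 0"
      using that by (intro ker) (auto simp: T_def polys_below_eq_image)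
    then have "x $ j = 0" if "j < d" for j
      using that by (auto simp: poly_eq_iff coeff_sum dest: spec[of _ j])
    then show ?thesis using that by (intro eq_vecI) auto
  qed
  have "inj_on T (carrier (module_vec TYPE('a) d))"
    by (rule Ke0_imp_inj)
      (use ker_T T0_is_0 in \<open>auto simp: mod_hom.ker_def module_vec_simps\<close>)
  then have "vectorspace.dim class_ring
      (module_vec TYPE('a) d\<lparr>carrier := kerT\<rparr>) = 0"
    by (rule inj_imp_dim_ker0)
  then have dim: "vectorspace.dim class_ring
      (module_vec TYPE('a) N\<lparr>carrier := imT\<rparr>) = d"
    using rank_nullity[OF V.fin_dim] V.dim_is_n by simp
  have im: "imT = \<phi> ` polys_below d"
    by (auto simp: im_def polys_below_eq_image T_def module_vec_simps)
  show ?thesis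
    unfolding linear_code_def code_dim_def
    using imT_is_subspace dim im by simp
qed

section \<open>Words of extended GRS codes and the MDS property\<close>

definition grs_word :: "nat \<Rightarrow> nat \<Rightarrow> 'a::field vec \<Rightarrow> 'a vec \<Rightarrow> 'a poly \<Rightarrow> 'a vec" where
  "grs_word n k a v f =
     vec (n + 1) (\<lambda>i. if i < n then v $ i * poly f (a $ i) else coeff f (k - 1))"

lemma grs_word_carrier [simp]: "grs_word n k a v f \<in> carrier_vec (Suc n)"
  by (simp add: grs_word_def)

lemma grs_word_add: "grs_word n k a v (f + g) = grs_word n k a v f + grs_word n k a v g"
  by (auto simp: grs_word_def algebra_simps)

lemma grs_word_diff: "grs_word n k a v (f - g) = grs_word n k a v f - grs_word n k a v g"
  by (auto simp: grs_word_def algebra_simps)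

lemma grs_word_smult: "grs_word n k a v (Polynomial.smult c f) = c \<cdot>\<^sub>v grs_word n k a v f"
  by (auto simp: grs_word_def)

lemma extended_grs_eq_image:
  "1 \<le> k \<Longrightarrow> extended_grs n k a v = grs_word n k a v ` polys_below k"
  by (auto simp: extended_grs_def grs_word_def polys_below_eq_degree_le)

lemma grs_word_scalar_prod:
  "grs_word n k a v f \<bullet> grs_word n k a v g =
     (\<Sum>i<n. (v $ i)\<^sup>2 * (poly f (a $ i) * poly g (a $ i))) + coeff f (k - 1) * coeff g (k - 1)"
  by (simp add: grs_word_def scalar_prod_def power2_eq_square algebra_simps lessThan_atLeast0)

text \<open>Since the \<open>a $ i\<close> are distinct, the zeros among the first \<open>n\<close>
  coordinates number at most \<open>degree f\<close>. The last coordinate adds a zero only if the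
  coefficient at \<open>k - 1\<close> vanishes, and then \<open>degree f < k - 1\<close> makes up
  for it.\<close>

lemma card_zeros_grs_word_le:
  fixes a v :: "'a::field vec"
  assumes "1 \<le> k" and inj: "inj_on (\<lambda>i. a $ i) {..<n}" and v: "\<forall>i<n. v $ i \<noteq> 0"
    and f: "f \<in> polys_below k" "f \<noteq> 0"
  shows "card {i. i < n + 1 \<and> grs_word n k a v f $ i = 0} \<le> k - 1"
proof -
  define Z where "Z = {i. i < n \<and> poly f (a $ i) = 0}"
  have "card Z = card ((\<lambda>i. a $ i) ` Z)"
    using inj by (intro card_image[symmetric]) (auto simp: Z_def inj_on_def)
  also have "\<dots> \<le> card {x. poly f x = 0}"
    using poly_roots_finite[OF f(2)] by (intro card_mono) (auto simp: Z_def)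
  also have "\<dots> \<le> degree f"
    by (rule card_poly_roots_bound[OF f(2)])
  finally have Z: "card Z \<le> degree f" .
  have deg: "degree f \<le> k - 1" using f by (auto simp: polys_below_iff)
  show ?thesis
  proof (cases "coeff f (k - 1) = 0")
    case True
    then have "degree f \<noteq> k - 1" using f(2) by (metis leading_coeff_0_iff)
    moreover have "card (insert n Z) \<le> Suc (card Z)" by (simp add: Z_def)
    moreover have "{i. i < n + 1 \<and> grs_word n k a v f $ i = 0} = insert n Z"
      using v True by (auto simp: grs_word_def Z_def less_Suc_eq)
    ultimately show ?thesis using deg Z by simp
  next
    case False
    then have "{i. i < n + 1 \<and> grs_word n k a v f $ i = 0} = Z"
      using v by (auto simp: grs_word_def Z_def less_Suc_eq)
    then show ?thesis using deg Z by simp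
  qed
qed

text \<open>A nonzero \<open>f\<close> would give \<open>n + 1\<close> zeros, more than the
  \<open>k - 1\<close> allowed.\<close>

lemma grs_word_eq_0_imp:
  fixes a v :: "'a::field vec"
  assumes "1 \<le> k" "k \<le> n" "inj_on (\<lambda>i. a $ i) {..<n}" "\<forall>i<n. v $ i \<noteq> 0"
    and "f \<in> polys_below k" "grs_word n k a v f = 0\<^sub>v (n + 1)"
  shows "f = 0"
proof (rule ccontr)
  assume "f \<noteq> 0"
  moreover have "{i. i < n + 1 \<and> grs_word n k a v f $ i = 0} = {..<n + 1}"
    using assms(6) by auto
  ultimately show False using card_zeros_grs_word_le[of k a n v f] assms by simp
qed

lemma degree_prod_linear: "degree (\<Prod>i<s. [:- c i, 1 :: 'a::idom:]) = s"
  by (subst degree_prod_eq_sum_degree) auto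

lemma min_distance_extended_grs:
  fixes a v :: "'a::{field,finite} vec"
  assumes k: "1 \<le> k" "k \<le> n"
    and inj: "inj_on (\<lambda>i. a $ i) {..<n}" and v: "\<forall>i<n. v $ i \<noteq> 0"
  shows "min_distance (extended_grs n k a v) = n + 1 - k + 1"
proof -
  let ?w = "grs_word n k a v"
  let ?Z = "\<lambda>f. {i. i < n + 1 \<and> ?w f $ i = 0}"
  \<comment> \<open>By linearity, two words agree exactly where the word of \<open>f - g\<close>
    vanishes.\<close>
  have dist: "hamming_dist (?w f) (?w g) = n + 1 - card (?Z (f - g))" for f g
  proof -
    have "{i. i < dim_vec (?w f) \<and> ?w f $ i \<noteq> ?w g $ i} = {..<n + 1} - ?Z (f - g)"
      by (auto simp: grs_word_diff carrier_vecD[OF grs_word_carrier])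
    moreover have "card ({..<n + 1} - ?Z (f - g)) = card {..<n + 1} - card (?Z (f - g))"
      by (rule card_Diff_subset) auto
    ultimately show ?thesis by (simp add: hamming_dist_def)
  qed
  \<comment> \<open>The bound on zeros is attained by a polynomial with \<open>k - 1\<close> of the
    evaluation points as roots.\<close>
  define p where "p = (\<Prod>i<k - 1. [:- a $ i, 1:])"
  have deg_p: "degree p = k - 1" by (simp add: p_def degree_prod_linear)
  have p: "p \<in> polys_below k" "p \<noteq> 0"
    using deg_p k by (auto simp: polys_below_iff p_def)
  have "{..<k - 1} \<subseteq> ?Z p"
    using k by (auto simp: grs_word_def p_def poly_prod)
  then have "card {..<k - 1} \<le> card (?Z p)" by (rule card_mono[rotated]) auto
  then have card_p: "card (?Z p) = k - 1"
    using card_zeros_grs_word_le[OF k(1) inj v p] by simp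
  have p_w: "?w p \<noteq> ?w 0"
  proof
    assume "?w p = ?w 0"
    then have "?w p = 0\<^sub>v (n + 1)" by (auto simp: grs_word_def)
    with grs_word_eq_0_imp[OF k inj v p(1)] p(2) show False by simp
  qed
  let ?D = "{hamming_dist x y |x y. x \<in> ?w ` polys_below k \<and> y \<in> ?w ` polys_below k \<and> x \<noteq> y}"
  have "Min ?D = n + 1 - (k - 1)"
  proof (rule Min_eqI)
    have "?D \<subseteq> {..n + 1}" using dist by auto
    then show "finite ?D" by (rule finite_subset) simp
    show "n + 1 - (k - 1) \<le> y" if "y \<in> ?D" for y
    proof -
      from that obtain f g where fg: "f \<in> polys_below k" "g \<in> polys_below k"
        "?w f \<noteq> ?w g" "y = hamming_dist (?w f) (?w g)" by auto
      then have "f - g \<noteq> 0" by auto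
      from card_zeros_grs_word_le[OF k(1) inj v polys_below_diff[OF fg(1,2)] this]
      show ?thesis unfolding fg(4) dist by (rule diff_le_mono2)
    qed
    have "n + 1 - (k - 1) = hamming_dist (?w p) (?w 0)" using card_p by (simp add: dist)
    moreover have "(0 :: 'a poly) \<in> polys_below k" by (simp add: polys_below_iff)
    ultimately show "n + 1 - (k - 1) \<in> ?D" using p(1) p_w by blast
  qed
  then show ?thesis using k by (simp add: min_distance_def extended_grs_eq_image)
qed

lemma mds_code_extended_grs:
  fixes a v :: "'a::{field,finite} vec"
  assumes k: "1 \<le> k" "k \<le> n"
    and inj: "inj_on (\<lambda>i. a $ i) {..<n}" and v: "\<forall>i<n. v $ i \<noteq> 0"
  shows "mds_code (n + 1) k (extended_grs n k a v)"
proof -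
  have "linear_code (n + 1) k (grs_word n k a v ` polys_below k)"
    using grs_word_carrier[unfolded Suc_eq_plus1] grs_word_add grs_word_smult
      grs_word_eq_0_imp[OF k inj v]
    by (rule linear_code_image_polys_below)
  then show ?thesis
    using min_distance_extended_grs[OF assms] k by (simp add: mds_code_def extended_grs_eq_image)
qed

section \<open>Subcodes of smaller dimension\<close>

text \<open>In the top position only the product of the two top coefficients contributes; if
  \<open>degree q < k - 1\<close>, both sides are zero.\<close>

lemma coeff_mult_polys_below:
  fixes p q :: "'a::idom poly"
  assumes "degree p = r" "1 \<le> k" "q \<in> polys_below k"
  shows "coeff (p * q) (r + k - 1) = lead_coeff p * coeff q (k - 1)"
proof (cases "degree q = k - 1")
  case True
  then show ?thesis using assms coeff_mult_degree_sum[of p q] by simp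
next
  case False
  then have "q = 0 \<or> degree q < k - 1" using assms by (auto simp: polys_below_iff)
  then show ?thesis
    using assms(1) degree_mult_le[of p q] by (auto simp: coeff_eq_0)
qed

text \<open>The values of \<open>(x - \<beta>) ^ (m - k)\<close> at the points are absorbed into the
  multipliers, and since this factor is monic, the last coordinate is unchanged.\<close>

lemma extended_grs_subcode:
  fixes a v :: "'a::field vec"
  assumes k: "1 \<le> k" "k \<le> m"
  shows "extended_grs n k a (vec n (\<lambda>i. v $ i * (a $ i - \<beta>) ^ (m - k))) \<subseteq> extended_grs n m a v"
proof -
  let ?v' = "vec n (\<lambda>i. v $ i * (a $ i - \<beta>) ^ (m - k))"
  define p where "p = [:- \<beta>, 1:] ^ (m - k)"
  have deg: "degree p = m - k" by (simp add: p_def degree_power_eq)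
  have lead: "lead_coeff p = 1" unfolding p_def by (simp add: lead_coeff_power)
  have "grs_word n k a ?v' f \<in> grs_word n m a v ` polys_below m" if f: "f \<in> polys_below k" for f
  proof
    show "p * f \<in> polys_below m" using polys_below_mult[OF eq_refl[OF deg] f] k by simp
    show "grs_word n k a ?v' f = grs_word n m a v (p * f)"
      using coeff_mult_polys_below[OF deg k(1) f] k lead
      by (auto simp: grs_word_def p_def poly_power mult_ac)
  qed
  then show ?thesis using k by (auto simp: extended_grs_eq_image)
qed

lemma self_orthogonal_subset:
  "D \<subseteq> C \<Longrightarrow> self_orthogonal N C \<Longrightarrow> self_orthogonal N D"
  by (auto simp: self_orthogonal_def euclidean_dual_def)

section \<open>The hull after rescaling the first coordinates\<close>

text \<open>Induction: the product of the earlier factors is nonzero at the new point, so the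
  cofactor must vanish there.\<close>

lemma prod_linear_dvd:
  fixes c :: "nat \<Rightarrow> 'a::field"
  assumes "inj_on c {..<s}" "\<forall>i<s. poly f (c i) = 0"
  shows "(\<Prod>i<s. [:- c i, 1:]) dvd f"
  using assms
proof (induction s)
  case (Suc s)
  then have "(\<Prod>i<s. [:- c i, 1:]) dvd f" by (auto simp: inj_on_def)
  then obtain h where h: "f = (\<Prod>i<s. [:- c i, 1:]) * h" ..
  have "c s \<noteq> c i" if "i < s" for i
    using inj_onD[OF Suc.prems(1), of s i] that by auto
  then have "poly (\<Prod>i<s. [:- c i, 1:]) (c s) \<noteq> 0" by (auto simp: poly_prod)
  moreover have "poly f (c s) = 0" using Suc.prems(2) by simp
  ultimately have "poly h (c s) = 0" using h by simp
  then have "[:- c s, 1:] dvd h" by (simp add: poly_eq_0_iff_dvd)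
  then show ?case unfolding h by (simp only: prod.lessThan_Suc mult_dvd_mono dvd_refl)
qed simp

definition scale_first :: "nat \<Rightarrow> nat \<Rightarrow> 'a::times \<Rightarrow> 'a vec \<Rightarrow> 'a vec" where
  "scale_first n s \<alpha> v = vec n (\<lambda>i. if i < s then \<alpha> * v $ i else v $ i)"

text \<open>Subtract the inner product of the unscaled words, which is zero by self-orthogonality.
  The last coordinate and those from \<open>s\<close> on cancel.\<close>

lemma scalar_prod_scale_first:
  fixes a v :: "'a::field vec"
  assumes so: "self_orthogonal (n + 1) (extended_grs n k a v)"
    and k: "1 \<le> k" and s: "s \<le> n" and f: "f \<in> polys_below k" and g: "g \<in> polys_below k"
  shows "grs_word n k a (scale_first n s \<alpha> v) f \<bullet> grs_word n k a (scale_first n s \<alpha> v) g =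
    (\<alpha>\<^sup>2 - 1) * (\<Sum>i<s. (v $ i)\<^sup>2 * (poly f (a $ i) * poly g (a $ i)))"
proof -
  let ?w = "scale_first n s \<alpha> v"
  let ?t = "\<lambda>u i. (u $ i)\<^sup>2 * (poly f (a $ i) * poly g (a $ i))"
  have "grs_word n k a v f \<bullet> grs_word n k a v g = 0"
    using so f g k by (auto simp: self_orthogonal_def euclidean_dual_def extended_grs_eq_image)
  then have "grs_word n k a ?w f \<bullet> grs_word n k a ?w g = (\<Sum>i<n. ?t ?w i) - (\<Sum>i<n. ?t v i)"
    by (simp add: grs_word_scalar_prod algebra_simps add_eq_0_iff)
  also have "\<dots> = (\<Sum>i<n. if i < s then (\<alpha>\<^sup>2 - 1) * ?t v i else 0)"
    unfolding sum_subtractf[symmetric]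
    by (intro sum.cong) (auto simp: scale_first_def power2_eq_square algebra_simps)
  also have "\<dots> = (\<Sum>i<s. (\<alpha>\<^sup>2 - 1) * ?t v i)"
    using s by (intro sum.mono_neutral_cong_right) auto
  finally show ?thesis by (simp add: sum_distrib_left)
qed

text \<open>Vanishing at the first \<open>s\<close> points means divisibility by their product; the
  cofactor ranges over \<open>polys_below (k - s)\<close>, from which the dimension can be read
  off.\<close>

lemma euclidean_hull_scale_first:
  fixes a v :: "'a::field vec"
  assumes so: "self_orthogonal (n + 1) (extended_grs n k a v)"
    and k: "1 \<le> k" "k \<le> n" and s: "s \<le> k" and \<alpha>: "\<alpha>\<^sup>2 \<noteq> 1"
    and inj: "inj_on (\<lambda>i. a $ i) {..<n}" and v: "\<forall>i<n. v $ i \<noteq> 0"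
  shows "euclidean_hull (n + 1) (extended_grs n k a (scale_first n s \<alpha> v)) =
    (\<lambda>h. grs_word n k a (scale_first n s \<alpha> v) ((\<Prod>i<s. [:- a $ i, 1:]) * h)) ` polys_below (k - s)"
    (is "?H = ?R")
proof -
  let ?w = "grs_word n k a (scale_first n s \<alpha> v)"
  define P where "P = (\<Prod>i<s. [:- a $ i, 1:])"
  have sn: "s \<le> n" using s k by simp
  have deg_P: "degree P = s" by (simp add: P_def degree_prod_linear)
  have P0: "P \<noteq> 0" by (simp add: P_def)
  have inj_s: "inj_on (\<lambda>i. a $ i) {..<s}" using inj sn by (auto simp: inj_on_def)
  note prod = scalar_prod_scale_first[OF so k(1) sn]
  have hull: "?H = ?w ` {f \<in> polys_below k. \<forall>g\<in>polys_below k. ?w f \<bullet> ?w g = 0}"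
    using k by (auto simp: euclidean_hull_def euclidean_dual_def extended_grs_eq_image)
  have "{f \<in> polys_below k. \<forall>g\<in>polys_below k. ?w f \<bullet> ?w g = 0} = (\<lambda>h. P * h) ` polys_below (k - s)"
  proof (intro equalityI subsetI)
    fix f assume "f \<in> {f \<in> polys_below k. \<forall>g\<in>polys_below k. ?w f \<bullet> ?w g = 0}"
    then have f: "f \<in> polys_below k" and orth: "\<And>g. g \<in> polys_below k \<Longrightarrow> ?w f \<bullet> ?w g = 0"
      by auto
    have "poly f (a $ i) = 0" if i: "i < s" for i
    proof -
      \<comment> \<open>Pair \<open>f\<close> with a polynomial that vanishes at the other points.\<close>
      define g where "g = (\<Prod>j\<in>{..<s} - {i}. [:- a $ j, 1:])"
      have "degree g = card ({..<s} - {i})"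
        unfolding g_def by (subst degree_prod_eq_sum_degree) auto
      \<comment> \<open>The degree is \<open>s - 1\<close>, which is below \<open>k\<close> because
        \<open>s \<le> k\<close>.\<close>
      then have g: "g \<in> polys_below k" using i s by (auto simp: polys_below_iff)
      have g_i: "poly g (a $ i) \<noteq> 0"
        using inj_s i by (auto simp: g_def poly_prod inj_on_def)
      have g_j: "poly g (a $ j) = 0" if "j < s" "j \<noteq> i" for j
        using that by (auto simp: g_def poly_prod)
      have "0 = (\<alpha>\<^sup>2 - 1) * (\<Sum>j<s. (v $ j)\<^sup>2 * (poly f (a $ j) * poly g (a $ j)))"
        using orth[OF g] prod[OF f g] by simp
      also have "(\<Sum>j<s. (v $ j)\<^sup>2 * (poly f (a $ j) * poly g (a $ j))) =
          (\<Sum>j\<in>{i}. (v $ j)\<^sup>2 * (poly f (a $ j) * poly g (a $ j)))"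
        using i g_j by (intro sum.mono_neutral_right) auto
      \<comment> \<open>In the one remaining term, every factor other than
        \<open>poly f (a $ i)\<close> is nonzero.\<close>
      finally show ?thesis using g_i \<alpha> v i sn by simp
    qed
    then have "P dvd f" unfolding P_def by (intro prod_linear_dvd inj_s) auto
    then obtain h where h: "f = P * h" ..
    then have "h \<in> polys_below (k - s)"
      using f deg_P P0 by (cases "h = 0") (auto simp: polys_below_iff degree_mult_eq)
    then show "f \<in> (\<lambda>h. P * h) ` polys_below (k - s)" using h by auto
  next
    fix f assume "f \<in> (\<lambda>h. P * h) ` polys_below (k - s)"
    then obtain h where h: "h \<in> polys_below (k - s)" "f = P * h" by auto
    have f: "f \<in> polys_below k"
      using polys_below_mult[OF eq_refl[OF deg_P] h(1)] s h(2) by simp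
    have "poly f (a $ i) = 0" if "i < s" for i using that by (auto simp: h(2) P_def poly_prod)
    then show "f \<in> {f \<in> polys_below k. \<forall>g\<in>polys_below k. ?w f \<bullet> ?w g = 0}"
      using f by (simp add: prod)
  qed
  then show ?thesis unfolding hull by (simp add: image_image P_def)
qed

text \<open>Multiplication by \<open>P\<close> and the word map are both injective here, the latter
  because \<open>\<alpha> \<noteq> 0\<close> keeps the multipliers nonzero.\<close>

lemma code_dim_hull_scale_first:
  fixes a v :: "'a::field vec"
  assumes so: "self_orthogonal (n + 1) (extended_grs n k a v)"
    and k: "1 \<le> k" "k \<le> n" and s: "s \<le> k" and \<alpha>: "\<alpha>\<^sup>2 \<noteq> 1" "\<alpha> \<noteq> 0"
    and inj: "inj_on (\<lambda>i. a $ i) {..<n}" and v: "\<forall>i<n. v $ i \<noteq> 0"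
  shows "code_dim (n + 1) (euclidean_hull (n + 1) (extended_grs n k a (scale_first n s \<alpha> v))) = k - s"
proof -
  define P where "P = (\<Prod>i<s. [:- a $ i, 1:])"
  have deg_P: "degree P = s" by (simp add: P_def degree_prod_linear)
  have P0: "P \<noteq> 0" by (simp add: P_def)
  have w: "\<forall>i<n. scale_first n s \<alpha> v $ i \<noteq> 0" using v \<alpha> by (simp add: scale_first_def)
  have "linear_code (n + 1) (k - s)
      ((\<lambda>h. grs_word n k a (scale_first n s \<alpha> v) (P * h)) ` polys_below (k - s))"
  proof (rule linear_code_image_polys_below)
    fix h assume h: "h \<in> polys_below (k - s)"
      and 0: "grs_word n k a (scale_first n s \<alpha> v) (P * h) = 0\<^sub>v (n + 1)"
    have "P * h \<in> polys_below k" using polys_below_mult[OF eq_refl[OF deg_P] h] s by simp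
    then have "P * h = 0" using 0 by (rule grs_word_eq_0_imp[OF k inj w])
    then show "h = 0" using P0 by simp
  qed (auto simp: grs_word_add grs_word_smult distrib_left)
  then show ?thesis
    unfolding euclidean_hull_scale_first[OF so k s \<alpha>(1) inj v] linear_code_def P_def by simp
qed

section \<open>Choice of \<open>\<alpha>\<close> and \<open>\<beta>\<close>, and conclusion\<close>

text \<open>In a field the excluded elements are just \<open>0\<close>, \<open>1\<close> and
  \<open>- 1\<close>, at most three.\<close>

lemma exists_nonzero_square_neq_1:
  assumes "CARD('a::{field,finite}) > 3"
  shows "\<exists>\<alpha>::'a. \<alpha> \<noteq> 0 \<and> \<alpha>\<^sup>2 \<noteq> 1"
proof (rule ccontr)
  assume "\<not> ?thesis"
  then have "(UNIV :: 'a set) \<subseteq> {0, 1, - 1}" by (auto simp: power2_eq_1_iff)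
  then have "CARD('a) \<le> card {0, 1, - 1 :: 'a}" by (rule card_mono[rotated]) simp
  also have "\<dots> \<le> 3" by (simp add: card_insert_if)
  finally show False using assms by simp
qed

theorem theorem2:
  fixes a v :: "'a::{field,finite} vec"
    and q n m :: nat
  assumes "q = CARD('a)" and "q > 3" and "n < q"
    and "1 \<le> m" and "m \<le> (n + 1) div 2"
    and "a \<in> carrier_vec n" and "\<forall>i<n. \<forall>j<n. i \<noteq> j \<longrightarrow> a $ i \<noteq> a $ j"
    and "v \<in> carrier_vec n" and "\<forall>i<n. v $ i \<noteq> 0"
    and "self_orthogonal (n + 1) (extended_grs n m a v)"
  shows "\<forall>k l. 1 \<le> k \<and> k \<le> m \<and> l \<le> k \<longrightarrow>
           (\<exists>C :: 'a vec set. mds_code (n + 1) k C \<and>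
              code_dim (n + 1) (euclidean_hull (n + 1) C) = l)"
proof (intro allI impI)
  fix k l assume "1 \<le> k \<and> k \<le> m \<and> l \<le> k"
  then have k: "1 \<le> k" "k \<le> m" and l: "l \<le> k" by auto
  \<comment> \<open>From \<open>2 * m \<le> n + 1\<close> and \<open>1 \<le> m\<close> one gets
    \<open>m \<le> n\<close>.\<close>
  have kn: "k \<le> n" using k(2) assms(4,5) by linarith
  have inj: "inj_on (\<lambda>i. a $ i) {..<n}" using assms(7) by (auto simp: inj_on_def)
  obtain \<alpha> :: 'a where \<alpha>: "\<alpha>\<^sup>2 \<noteq> 1" "\<alpha> \<noteq> 0"
    using exists_nonzero_square_neq_1 assms(1,2) by blast
  \<comment> \<open>As \<open>n < q\<close>, some field element is not an evaluation point; taking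
    it as \<open>\<beta>\<close> keeps the multipliers \<open>v'\<close> nonzero.\<close>
  have "card ((\<lambda>i. a $ i) ` {..<n}) < CARD('a)"
    using card_image_le[of "{..<n}" "\<lambda>i. a $ i"] assms(1,3) by simp
  then have "(\<lambda>i. a $ i) ` {..<n} \<noteq> UNIV" by auto
  then obtain \<beta> where \<beta>: "\<beta> \<notin> (\<lambda>i. a $ i) ` {..<n}" by blast
  define v' where "v' = vec n (\<lambda>i. v $ i * (a $ i - \<beta>) ^ (m - k))"
  have v': "\<forall>i<n. v' $ i \<noteq> 0" using assms(9) \<beta> by (auto simp: v'_def)
  have so: "self_orthogonal (n + 1) (extended_grs n k a v')"
    unfolding v'_def by (rule self_orthogonal_subset[OF extended_grs_subcode[OF k] assms(10)])
  \<comment> \<open>Scaling \<open>k - l\<close> coordinates leaves a hull of dimension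
    \<open>k - (k - l) = l\<close>.\<close>
  define w where "w = scale_first n (k - l) \<alpha> v'"
  have w: "\<forall>i<n. w $ i \<noteq> 0" using v' \<alpha> by (simp add: w_def scale_first_def)
  have "mds_code (n + 1) k (extended_grs n k a w)"
    by (rule mds_code_extended_grs[OF k(1) kn inj w])
  moreover have "code_dim (n + 1) (euclidean_hull (n + 1) (extended_grs n k a w)) = l"
    using code_dim_hull_scale_first[OF so k(1) kn _ \<alpha> inj v', of "k - l"] l by (simp add: w_def)
  ultimately show "\<exists>C :: 'a vec set. mds_code (n + 1) k C \<and>
      code_dim (n + 1) (euclidean_hull (n + 1) C) = l" by blast
qed

end
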